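(* Let $t,n\in\mathbb{N}$ with $n\ge t$. If $n$ is even, or if $t-1$ is even and $2t\ne n+1$, then any $(1,t)$-extremal cograph on $n$ vertices is $(t-1)$-regular. Otherwise, any $(1,t)$-extremal cograph on $n$ vertices is the sum of a $(t-1)$-regular cograph and a connected remainder of size at most $2t-3$.
   Context: Graphs are finite and simple; $\mathbb{N}=\{1,2,\dots\}$. A cograph is a graph with no induced path $P_4$ on four vertices; the null graph (no vertices) is allowed as a cograph and is the identity for the sum. The sum $G_1+G_2$ is the disjoint union of $G_1$ and $G_2$. The size of a graph is its number of vertices. $K_{1,t}$ is the star with $t$ leaves. A cograph is $(1,t)$-extremal if it has the maximum number of edges among all cographs with the same number of vertices not containing $K_{1,t}$ as a (not necessarily induced) subgraph.
   Formalization: For t = n = 1 the stated bound 2t-3 = -1 cannot be met by any remainder, so the claim fails for the single vertex; the bound is read as max(0, 2t-3), and the null graph counts as connected. *)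

theory Defs
  imports Main
begin

record 'a graph =
  verts :: "'a set"
  edges :: "'a set set"

definition simple_graph :: "'a graph \<Rightarrow> bool" where
  "simple_graph G \<longleftrightarrow> finite (verts G) \<and> (\<forall>e\<in>edges G. e \<subseteq> verts G \<and> card e = 2)"

definition contains_subgraph :: "'a graph \<Rightarrow> 'b graph \<Rightarrow> bool" where
  "contains_subgraph G H \<longleftrightarrow>
     (\<exists>f. inj_on f (verts H) \<and> f ` verts H \<subseteq> verts G \<and>
          (\<forall>x\<in>verts H. \<forall>y\<in>verts H. {x, y} \<in> edges H \<longrightarrow> {f x, f y} \<in> edges G))"

definition contains_induced_subgraph :: "'a graph \<Rightarrow> 'b graph \<Rightarrow> bool" where
  "contains_induced_subgraph G H \<longleftrightarrow>
     (\<exists>f. inj_on f (verts H) \<and> f ` verts H \<subseteq> verts G \<and>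
          (\<forall>x\<in>verts H. \<forall>y\<in>verts H. {x, y} \<in> edges H \<longleftrightarrow> {f x, f y} \<in> edges G))"

definition P4 :: "nat graph" where
  "P4 = \<lparr>verts = {0, 1, 2, 3}, edges = {{0, 1}, {1, 2}, {2, 3}}\<rparr>"

(* K_{1,t}, with centre 0 and leaves 1, ..., t *)
definition star :: "nat \<Rightarrow> nat graph" where
  "star t = \<lparr>verts = {0..t}, edges = {{0, i} | i. i \<in> {1..t}}\<rparr>"

(* The null graph is a cograph. *)
definition cograph :: "'a graph \<Rightarrow> bool" where
  "cograph G \<longleftrightarrow> simple_graph G \<and> \<not> contains_induced_subgraph G P4"

(* The competitors H range over graphs with vertices in the type of the vertices of G.
   This loses no generality: every graph with as many vertices as G has an isomorphic
   copy on the set verts G. *)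
definition star_extremal :: "nat \<Rightarrow> 'a graph \<Rightarrow> bool" where
  "star_extremal t G \<longleftrightarrow>
     cograph G \<and> \<not> contains_subgraph G (star t) \<and>
     (\<forall>H :: 'a graph. cograph H \<and> card (verts H) = card (verts G) \<and>
        \<not> contains_subgraph H (star t) \<longrightarrow> card (edges H) \<le> card (edges G))"

definition degree :: "'a graph \<Rightarrow> 'a \<Rightarrow> nat" where
  "degree G v = card {e \<in> edges G. v \<in> e}"

(* The null graph is d-regular for every d. *)
definition regular :: "nat \<Rightarrow> 'a graph \<Rightarrow> bool" where
  "regular d G \<longleftrightarrow> (\<forall>v\<in>verts G. degree G v = d)"

(* Any two vertices are joined by a walk; in particular the null graph is connected.
   For t = n = 1 the extremal graph K_1 is itself 0-regular, so that the remainder is the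
   null graph, and its size is bounded by 2 * t - 3 = 0, with subtraction truncated at 0. *)
definition connected_graph :: "'a graph \<Rightarrow> bool" where
  "connected_graph G \<longleftrightarrow>
     (\<forall>u\<in>verts G. \<forall>v\<in>verts G. (u, v) \<in> {(x, y). {x, y} \<in> edges G}\<^sup>*)"

(* G is the disjoint union of its subgraphs G1 and G2. *)
definition is_sum :: "'a graph \<Rightarrow> 'a graph \<Rightarrow> 'a graph \<Rightarrow> bool" where
  "is_sum G G1 G2 \<longleftrightarrow>
     verts G1 \<inter> verts G2 = {} \<and>
     verts G = verts G1 \<union> verts G2 \<and> edges G = edges G1 \<union> edges G2"

end

theory Submission
  imports Defs
begin

text \<open>Put \<open>d = t - 1\<close>; avoiding \<open>K\<^bsub>1,t\<^esub>\<close> means having maximum degree at most \<open>d\<close>.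
  Complements and disjoint unions of cographs are cographs, and these two operations yield
  \<open>d\<close>-regular cographs on \<open>n > d\<close> vertices whenever \<open>n\<close> is even, or \<open>d\<close> is even and
  \<open>n \<noteq> 2d + 1\<close>; this settles the regular case by counting degrees. By Seinsche's theorem
  a connected cograph with at least two vertices is a join, so with maximum degree at most \<open>d\<close> it has
  at most \<open>2d\<close> vertices, and exactly \<open>2d\<close> only if it is \<open>d\<close>-regular. It remains to exclude two
  non-regular components \<open>C\<close>, \<open>C'\<close>, on \<open>m\<close> vertices together: replacing them
  by \<open>K\<^sub>m\<close> (if \<open>m \<le> d + 1\<close>), by a \<open>d\<close>-regular cograph, by \<open>K\<^bsub>d+1\<^esub> + K\<^sub>d\<close>
  (if \<open>m = 2d + 1\<close>), or by a cograph all of whose degrees are \<open>d\<close> except for a single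
  \<open>d - 1\<close> (if \<open>m\<close> and \<open>d\<close> are odd) gains an edge.\<close>

section \<open>Degrees, complements and disjoint unions\<close>

lemma simple_graph_edge:
  assumes "simple_graph G" "{x, y} \<in> edges G"
  shows "x \<in> verts G" "y \<in> verts G" "x \<noteq> y"
  using assms by (auto simp: simple_graph_def)

lemma simple_graph_finite_verts: "simple_graph G \<Longrightarrow> finite (verts G)"
  by (simp add: simple_graph_def)

lemma simple_graph_finite_edges:
  assumes "simple_graph G"
  shows "finite (edges G)"
proof (rule finite_subset)
  show "edges G \<subseteq> Pow (verts G)"
    using assms by (auto simp: simple_graph_def)
qed (use assms in \<open>simp add: simple_graph_def\<close>)

lemma degree_eq_card_neighbours:
  assumes "simple_graph G"
  shows "degree G v = card {u. {v, u} \<in> edges G}"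
proof -
  have "{e \<in> edges G. v \<in> e} = (\<lambda>u. {v, u}) ` {u. {v, u} \<in> edges G}"
  proof -
    have "\<exists>u. e = {v, u}" if "e \<in> edges G" "v \<in> e" for e
    proof -
      have "card e = 2"
        using assms that by (auto simp: simple_graph_def)
      then show ?thesis
        using that(2) by (auto simp: card_2_iff)
    qed
    then show ?thesis by blast
  qed
  moreover have "inj_on (\<lambda>u. {v, u}) {u. {v, u} \<in> edges G}"
    by (auto simp: inj_on_def doubleton_eq_iff)
  ultimately show ?thesis
    by (simp add: degree_def card_image)
qed

lemma finite_neighbours:
  assumes "simple_graph G"
  shows "finite {u. {v, u} \<in> edges G}"
  by (rule finite_subset[OF _ simple_graph_finite_verts[OF assms]])
    (auto dest: simple_graph_edge[OF assms])

lemma sum_degree: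
  assumes "simple_graph G"
  shows "(\<Sum>v\<in>verts G. degree G v) = 2 * card (edges G)"
  unfolding degree_def
proof (rule sum_multicount)
  show "\<forall>e\<in>edges G. card {v \<in> verts G. v \<in> e} = 2"
  proof
    fix e assume "e \<in> edges G"
    with assms have "e \<subseteq> verts G" "card e = 2"
      by (auto simp: simple_graph_def)
    then show "card {v \<in> verts G. v \<in> e} = 2"
      by (metis Collect_mem_eq Int_absorb1 Int_def inf_commute)
  qed
qed (use assms in \<open>auto simp: simple_graph_finite_verts simple_graph_finite_edges\<close>)

text \<open>All neighbours of \<open>v\<close> lie in \<open>S\<close> and differ from
  \<open>v\<close>. This bounds the degree sum of a small closed part.\<close>

lemma degree_less_card_closed:
  assumes G: "simple_graph G" and S: "finite S" "v \<in> S"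
    and closed: "\<And>x y. x \<in> S \<Longrightarrow> {x, y} \<in> edges G \<Longrightarrow> y \<in> S"
  shows "degree G v < card S"
proof -
  have "{u. {v, u} \<in> edges G} \<subseteq> S - {v}"
    using S(2) closed simple_graph_edge(3)[OF G] by auto
  then have "degree G v \<le> card (S - {v})"
    unfolding degree_eq_card_neighbours[OF G] by (intro card_mono) (use S in auto)
  also have "\<dots> < card S"
    using S by (rule card_Diff1_less)
  finally show ?thesis .
qed

text \<open>The leaves of a star go to distinct neighbours of the image of its centre, and any
  \<open>t\<close> neighbours can be numbered as leaves. Avoiding a star thus becomes a degree
  bound.\<close>

lemma contains_star_iff:
  assumes G: "simple_graph G" and t: "1 \<le> t"
  shows "contains_subgraph G (star t) \<longleftrightarrow> (\<exists>v\<in>verts G. t \<le> degree G v)"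
proof
  assume "contains_subgraph G (star t)"
  then obtain f where f: "inj_on f {0..t}" "f ` {0..t} \<subseteq> verts G"
    "\<And>x y. x \<in> {0..t} \<Longrightarrow> y \<in> {0..t} \<Longrightarrow> {x, y} \<in> edges (star t) \<Longrightarrow> {f x, f y} \<in> edges G"
    by (auto simp: contains_subgraph_def star_def)
  have "{0, i} \<in> edges (star t)" if "i \<in> {1..t}" for i
    using that by (auto simp: star_def)
  then have "f ` {1..t} \<subseteq> {u. {f 0, u} \<in> edges G}"
    using f(3)[of 0] by auto
  then have "card (f ` {1..t}) \<le> degree G (f 0)"
    unfolding degree_eq_card_neighbours[OF G] by (intro card_mono finite_neighbours[OF G])
  moreover have "card (f ` {1..t}) = t"
    using inj_on_subset[OF f(1), of "{1..t}"] by (simp add: card_image)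
  ultimately show "\<exists>v\<in>verts G. t \<le> degree G v"
    using f(2) by (intro bexI[of _ "f 0"]) auto
next
  assume "\<exists>v\<in>verts G. t \<le> degree G v"
  then obtain v where v: "v \<in> verts G" "t \<le> card {u. {v, u} \<in> edges G}"
    by (auto simp: degree_eq_card_neighbours[OF G])
  obtain N where N: "N \<subseteq> {u. {v, u} \<in> edges G}" "card N = t" "finite N"
    using obtain_subset_with_card_n[OF v(2)] by metis
  obtain g where g: "bij_betw g {1..t} N"
    using finite_same_card_bij[of "{1..t}" N] N by auto
  define f where "f = (\<lambda>i. if i = 0 then v else g i)"
  have g_edge: "{v, g i} \<in> edges G" if "i \<in> {1..t}" for i
    using bij_betwE[OF g] N(1) that by blast
  have "inj_on f {0..t}"
  proof (rule inj_onI)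
    fix i j assume ij: "i \<in> {0..t}" "j \<in> {0..t}" "f i = f j"
    have ne: "g k \<noteq> v" if "k \<in> {1..t}" for k
      using simple_graph_edge(3)[OF G g_edge[OF that]] by simp
    consider "i = 0" "j = 0" | "i = 0" "j \<in> {1..t}" | "i \<in> {1..t}" "j = 0"
      | "i \<in> {1..t}" "j \<in> {1..t}"
      using ij(1,2) by fastforce
    then show "i = j"
    proof cases
      case 4
      then show ?thesis
        using ij(3) bij_betw_imp_inj_on[OF g] by (simp add: f_def inj_on_eq_iff)
    qed (use ij(3) ne[of i] ne[of j] in \<open>auto simp: f_def\<close>)
  qed
  moreover have "f x \<in> verts G" if "x \<in> {0..t}" for x
    using v(1) simple_graph_edge(2)[OF G g_edge[of x]] that by (cases "x = 0") (auto simp: f_def)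
  then have "f ` {0..t} \<subseteq> verts G" by blast
  moreover have "{f x, f y} \<in> edges G"
    if xy: "{x, y} \<in> edges (star t)" for x y
  proof -
    obtain i where "{x, y} = {0, i}" "i \<in> {1..t}"
      using xy by (auto simp: star_def)
    then show ?thesis
      using g_edge[of i] by (auto simp: f_def doubleton_eq_iff insert_commute)
  qed
  ultimately show "contains_subgraph G (star t)"
    unfolding contains_subgraph_def by (intro exI[of _ f]) (simp add: star_def)
qed

text \<open>Distinctness of \<open>a\<close>, \<open>b\<close>, \<open>c\<close>, \<open>d\<close>
  follows from the pattern: identifying two of them would create a loop or turn a required edge into
  a forbidden one.\<close>

lemma contains_P4_iff:
  fixes G :: "'a graph"
  assumes G: "simple_graph G"
  shows "contains_induced_subgraph G P4 \<longleftrightarrow>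
    (\<exists>a b c d. {a, b} \<in> edges G \<and> {b, c} \<in> edges G \<and> {c, d} \<in> edges G \<and>
      {a, c} \<notin> edges G \<and> {b, d} \<notin> edges G \<and> {a, d} \<notin> edges G)"
proof
  assume "contains_induced_subgraph G P4"
  then obtain f :: "nat \<Rightarrow> 'a" where *: "\<forall>x\<in>{0, 1, 2, 3}. \<forall>y\<in>{0, 1, 2, 3}.
      {x, y} \<in> {{0, 1}, {1, 2}, {2, 3}} \<longleftrightarrow> {f x, f y} \<in> edges G"
    unfolding contains_induced_subgraph_def P4_def graph.simps by (elim exE conjE) (rule that)
  have f: "{f x, f y} \<in> edges G \<longleftrightarrow> {x, y} \<in> {{0, 1}, {1, 2}, {2, 3}}"
    if "x \<in> {0, 1, 2, 3}" "y \<in> {0, 1, 2, 3}" for x y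
    using bspec[OF bspec[OF * that(1)] that(2)] by (rule sym)
  show "\<exists>a b c d. {a, b} \<in> edges G \<and> {b, c} \<in> edges G \<and> {c, d} \<in> edges G \<and>
      {a, c} \<notin> edges G \<and> {b, d} \<notin> edges G \<and> {a, d} \<notin> edges G"
    using f[of 0 1] f[of 1 2] f[of 2 3] f[of 0 2] f[of 1 3] f[of 0 3]
    by (intro exI[of _ "f 0"] exI[of _ "f 1"] exI[of _ "f 2"] exI[of _ "f 3"])
      (simp add: doubleton_eq_iff)
next
  assume "\<exists>a b c d. {a, b} \<in> edges G \<and> {b, c} \<in> edges G \<and> {c, d} \<in> edges G \<and>
      {a, c} \<notin> edges G \<and> {b, d} \<notin> edges G \<and> {a, d} \<notin> edges G"
  then obtain a b c d where e: "{a, b} \<in> edges G" "{b, c} \<in> edges G" "{c, d} \<in> edges G"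
      "{a, c} \<notin> edges G" "{b, d} \<notin> edges G" "{a, d} \<notin> edges G"
    by blast
  define f where "f = (\<lambda>i::nat. if i = 0 then a else if i = 1 then b else if i = 2 then c else d)"
  have V: "a \<in> verts G" "b \<in> verts G" "c \<in> verts G" "d \<in> verts G"
    using e simple_graph_edge[OF G] by blast+
  have ne: "a \<noteq> b" "b \<noteq> c" "c \<noteq> d" "a \<noteq> c" "b \<noteq> d" "a \<noteq> d"
    using e simple_graph_edge(3)[OF G] by (auto simp: insert_commute)
  have loop: "{x, x} \<notin> edges G" for x
    using simple_graph_edge(3)[OF G, of x x] by auto
  have f: "f 0 = a" "f 1 = b" "f 2 = c" "f 3 = d"
    by (simp_all add: f_def)
  have "\<forall>x\<in>{0, 1, 2, 3}. \<forall>y\<in>{0, 1, 2, 3}.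
      {x, y} \<in> {{0, 1}, {1, 2}, {2, 3}} \<longleftrightarrow> {f x, f y} \<in> edges G"
    unfolding ball_simps f using e loop
    by (simp add: doubleton_eq_iff insert_commute[of b a] insert_commute[of c a]
        insert_commute[of d a] insert_commute[of c b] insert_commute[of d b] insert_commute[of d c])
  moreover have "inj_on f {0, 1, 2, 3}" "f ` {0, 1, 2, 3} \<subseteq> verts G"
    using ne V unfolding inj_on_def ball_simps image_insert f by auto
  ultimately show "contains_induced_subgraph G P4"
    unfolding contains_induced_subgraph_def P4_def graph.simps by (intro exI[of _ f] conjI)
qed

lemma cograph_iff:
  "cograph G \<longleftrightarrow> simple_graph G \<and>
    \<not> (\<exists>a b c d. {a, b} \<in> edges G \<and> {b, c} \<in> edges G \<and> {c, d} \<in> edges G \<and>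
      {a, c} \<notin> edges G \<and> {b, d} \<notin> edges G \<and> {a, d} \<notin> edges G)"
  using contains_P4_iff unfolding cograph_def by blast

lemma cograph_simple: "cograph G \<Longrightarrow> simple_graph G"
  by (simp add: cograph_def)

definition complement :: "'a graph \<Rightarrow> 'a graph" where
  "complement G = \<lparr>verts = verts G, edges = {e. e \<subseteq> verts G \<and> card e = 2} - edges G\<rparr>"

lemma verts_complement [simp]: "verts (complement G) = verts G"
  by (simp add: complement_def)

lemma edge_complement_iff:
  "{x, y} \<in> edges (complement G) \<longleftrightarrow>
    x \<in> verts G \<and> y \<in> verts G \<and> x \<noteq> y \<and> {x, y} \<notin> edges G"
  by (auto simp: complement_def)

text \<open>\<open>P4\<close> is self-complementary: an induced path a-b-c-d of the complement gives
  the induced path c-a-d-b of \<open>G\<close>.\<close>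

lemma cograph_complement:
  assumes "cograph G"
  shows "cograph (complement G)"
  unfolding cograph_iff
proof (intro conjI notI)
  show "simple_graph (complement G)"
    using assms by (auto simp: complement_def cograph_def simple_graph_def)
next
  assume "\<exists>a b c d. {a, b} \<in> edges (complement G) \<and> {b, c} \<in> edges (complement G) \<and>
    {c, d} \<in> edges (complement G) \<and> {a, c} \<notin> edges (complement G) \<and>
    {b, d} \<notin> edges (complement G) \<and> {a, d} \<notin> edges (complement G)"
  then obtain a b c d where *: "{a, b} \<in> edges (complement G)" "{b, c} \<in> edges (complement G)"
    "{c, d} \<in> edges (complement G)" "{a, c} \<notin> edges (complement G)"
    "{b, d} \<notin> edges (complement G)" "{a, d} \<notin> edges (complement G)"
    by blast
  then have "a \<noteq> c" "b \<noteq> d" "a \<noteq> d"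
    by (auto simp: insert_commute)
  with * have "{c, a} \<in> edges G" "{a, d} \<in> edges G" "{d, b} \<in> edges G"
    "{c, d} \<notin> edges G" "{a, b} \<notin> edges G" "{c, b} \<notin> edges G"
    by (auto simp: edge_complement_iff insert_commute)
  then show False
    using assms unfolding cograph_iff by blast
qed

lemma degree_complement:
  assumes G: "simple_graph G" and v: "v \<in> verts G"
  shows "degree (complement G) v = card (verts G) - 1 - degree G v"
proof -
  have "simple_graph (complement G)"
    using G by (auto simp: complement_def simple_graph_def)
  then have "degree (complement G) v = card {u. {v, u} \<in> edges (complement G)}"
    by (rule degree_eq_card_neighbours)
  also have "{u. {v, u} \<in> edges (complement G)} = (verts G - {v}) - {u. {v, u} \<in> edges G}"
    using v by (auto simp: edge_complement_iff)
  also have "card \<dots> = card (verts G - {v}) - card {u. {v, u} \<in> edges G}"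
    by (intro card_Diff_subset finite_neighbours[OF G]) (auto dest: simple_graph_edge[OF G])
  finally show ?thesis
    using v by (simp add: degree_eq_card_neighbours[OF G])
qed

lemma cograph_union:
  assumes G: "cograph G" and H: "cograph H" and disj: "verts G \<inter> verts H = {}"
  shows "cograph \<lparr>verts = verts G \<union> verts H, edges = edges G \<union> edges H\<rparr>"
  unfolding cograph_iff
proof (intro conjI notI)
  show "simple_graph \<lparr>verts = verts G \<union> verts H, edges = edges G \<union> edges H\<rparr>"
    using G H by (auto simp: cograph_def simple_graph_def)
next
  \<comment> \<open>Edges that share a vertex lie in the same summand, so all three edges of a path
    do.\<close>
  have transfer: "{y, z} \<in> edges G \<Longrightarrow> {x, y} \<in> edges G \<union> edges H \<Longrightarrow> {x, y} \<in> edges G"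
    "{y, z} \<in> edges H \<Longrightarrow> {x, y} \<in> edges G \<union> edges H \<Longrightarrow> {x, y} \<in> edges H" for x y z
    using simple_graph_edge[OF cograph_simple[OF G]] simple_graph_edge[OF cograph_simple[OF H]] disj
    by blast+
  let ?E = "edges \<lparr>verts = verts G \<union> verts H, edges = edges G \<union> edges H\<rparr>"
  assume "\<exists>a b c d. {a, b} \<in> ?E \<and> {b, c} \<in> ?E \<and> {c, d} \<in> ?E \<and>
    {a, c} \<notin> ?E \<and> {b, d} \<notin> ?E \<and> {a, d} \<notin> ?E"
  then obtain a b c d where
    *: "{a, b} \<in> edges G \<union> edges H" "{b, c} \<in> edges G \<union> edges H" "{c, d} \<in> edges G \<union> edges H"
    "{a, c} \<notin> edges G \<union> edges H" "{b, d} \<notin> edges G \<union> edges H" "{a, d} \<notin> edges G \<union> edges H"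
    by auto
  then consider "{c, d} \<in> edges G" "{b, c} \<in> edges G" "{a, b} \<in> edges G"
    | "{c, d} \<in> edges H" "{b, c} \<in> edges H" "{a, b} \<in> edges H"
    using transfer by blast
  then show False
    using * G H unfolding cograph_iff by cases blast+
qed

section \<open>Induced subgraphs and unions of components\<close>

definition induced :: "'a graph \<Rightarrow> 'a set \<Rightarrow> 'a graph" where
  "induced G S = \<lparr>verts = S, edges = {e \<in> edges G. e \<subseteq> S}\<rparr>"

lemma simple_induced: "simple_graph G \<Longrightarrow> S \<subseteq> verts G \<Longrightarrow> simple_graph (induced G S)"
  by (auto simp: induced_def simple_graph_def intro: finite_subset)

lemma cograph_induced:
  assumes "cograph G" "S \<subseteq> verts G"
  shows "cograph (induced G S)"
proof -
  have "\<not> (\<exists>a b c d. {a, b} \<in> edges (induced G S) \<and> {b, c} \<in> edges (induced G S) \<and>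
    {c, d} \<in> edges (induced G S) \<and> {a, c} \<notin> edges (induced G S) \<and>
    {b, d} \<notin> edges (induced G S) \<and> {a, d} \<notin> edges (induced G S))"
    using assms(1) unfolding cograph_iff induced_def by auto
  then show ?thesis
    using simple_induced[OF cograph_simple[OF assms(1)] assms(2)] unfolding cograph_iff by blast
qed

text \<open>In a simple graph these are the unions of connected components, described by edges so
  that exchange arguments need no walks.\<close>

definition closed_in :: "'a graph \<Rightarrow> 'a set \<Rightarrow> bool" where
  "closed_in G S \<longleftrightarrow> S \<subseteq> verts G \<and> (\<forall>e\<in>edges G. e \<subseteq> S \<or> e \<inter> S = {})"

lemma closed_in_compl:
  assumes "simple_graph G" "closed_in G S"
  shows "closed_in G (verts G - S)"
  using assms unfolding closed_in_def simple_graph_def by blast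

lemma closed_in_edge: "closed_in G S \<Longrightarrow> x \<in> S \<Longrightarrow> {x, y} \<in> edges G \<Longrightarrow> y \<in> S"
  unfolding closed_in_def by (drule conjunct2, drule bspec) auto

lemma closed_in_Un: "closed_in G S \<Longrightarrow> closed_in G T \<Longrightarrow> closed_in G (S \<union> T)"
  unfolding closed_in_def by (simp add: Int_Un_distrib) (meson Un_upper1 Un_upper2 order_trans)

lemma degree_induced_closed:
  assumes "closed_in G S" "v \<in> S"
  shows "degree (induced G S) v = degree G v"
proof -
  have "{e \<in> edges (induced G S). v \<in> e} = {e \<in> edges G. v \<in> e}"
    using assms by (auto simp: induced_def closed_in_def)
  then show ?thesis by (simp add: degree_def)
qed

section \<open>Degree functions realised by cographs\<close>

text \<open>Replacement graphs matter only through their degrees. Since \<open>f\<close> is total on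
  the type, one function can serve several disjoint vertex sets.\<close>

definition realises :: "'a set \<Rightarrow> ('a \<Rightarrow> nat) \<Rightarrow> bool" where
  "realises V f \<longleftrightarrow> (\<exists>H. cograph H \<and> verts H = V \<and> (\<forall>v\<in>V. degree H v = f v))"

lemma realises_cong: "realises V f \<Longrightarrow> (\<And>v. v \<in> V \<Longrightarrow> f v = g v) \<Longrightarrow> realises V g"
  by (force simp: realises_def)

lemma realises_zero:
  assumes "finite V"
  shows "realises V (\<lambda>_. 0)"
  unfolding realises_def
  by (intro exI[of _ "\<lparr>verts = V, edges = {}\<rparr>"])
    (use assms in \<open>auto simp: cograph_iff simple_graph_def degree_def\<close>)

lemma realises_complement:
  assumes "realises V f"
  shows "realises V (\<lambda>v. card V - 1 - f v)"
proof -
  from assms obtain H where H: "cograph H" "verts H = V" "\<forall>v\<in>V. degree H v = f v"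
    by (auto simp: realises_def)
  then show ?thesis
    unfolding realises_def using cograph_complement[OF H(1)] degree_complement[OF cograph_simple[OF H(1)]]
    by (intro exI[of _ "complement H"]) auto
qed

lemma realises_union:
  assumes "realises A f" "realises B f" "A \<inter> B = {}"
  shows "realises (A \<union> B) f"
proof -
  from assms obtain G H where G: "cograph G" "verts G = A" "\<forall>v\<in>A. degree G v = f v"
    and H: "cograph H" "verts H = B" "\<forall>v\<in>B. degree H v = f v"
    by (auto simp: realises_def)
  let ?U = "\<lparr>verts = verts G \<union> verts H, edges = edges G \<union> edges H\<rparr>"
  have "cograph ?U"
    by (rule cograph_union) (use G H assms(3) in auto)
  moreover have "degree ?U v = f v" if "v \<in> A" for v
  proof -
    have "{e \<in> edges ?U. v \<in> e} = {e \<in> edges G. v \<in> e}"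
      using that H assms(3) by (auto simp: cograph_def simple_graph_def)
    then show ?thesis using G that by (simp add: degree_def)
  qed
  moreover have "degree ?U v = f v" if "v \<in> B" for v
  proof -
    have "{e \<in> edges ?U. v \<in> e} = {e \<in> edges H. v \<in> e}"
      using that G assms(3) by (auto simp: cograph_def simple_graph_def)
    then show ?thesis using H that by (simp add: degree_def)
  qed
  ultimately show ?thesis
    unfolding realises_def using G(2) H(2) by (intro exI[of _ ?U]) auto
qed

lemma realises_complete:
  assumes "finite V"
  shows "realises V (\<lambda>_. card V - 1)"
  using realises_complement[OF realises_zero[OF assms]] by simp

lemma split_finite_set:
  assumes "finite V" "k \<le> card V"
  obtains A B where "A \<union> B = V" "A \<inter> B = {}" "finite A" "finite B"
    "card A = k" "card B = card V - k"
proof -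
  obtain A where "A \<subseteq> V" "card A = k"
    using obtain_subset_with_card_n[OF assms(2)] by metis
  then show ?thesis
    using assms(1) by (intro that[of A "V - A"]) (auto simp: card_Diff_subset finite_subset)
qed

text \<open>Induction on order plus degree: up to \<open>2 * d\<close> vertices pass to the
  complement, beyond \<open>2 * d + 1\<close> split \<open>V\<close> in two. At exactly
  \<open>2 * d + 1\<close> vertices the complement has the same degree, and two sets of more than
  \<open>d\<close> vertices do not fit.\<close>

lemma realises_regular:
  assumes "finite V" "d < card V" "even (card V) \<or> even d \<and> card V \<noteq> 2 * d + 1"
  shows "realises V (\<lambda>_. d)"
  using assms
proof (induction "card V + d" arbitrary: V d rule: less_induct)
  case less
  consider "d = 0" | "d > 0" "card V \<le> 2 * d" | "d > 0" "card V > 2 * d + 1"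
    using less.prems by fastforce
  then show ?case
  proof cases
    case 1
    then show ?thesis using realises_zero less.prems by simp
  next
    case 2
    \<comment> \<open>Here \<open>c < d\<close>, so the induction measure drops. For odd
      \<open>card V\<close> the parities of \<open>c\<close> and \<open>d\<close> agree, and the
      exceptional size \<open>2 * c + 1\<close> would force \<open>c = d\<close>.\<close>
    define c where "c = card V - 1 - d"
    have "card V = c + d + 1" using less.prems by (simp add: c_def)
    then have "realises V (\<lambda>_. c)"
      using less.prems 2 by (intro less.hyps) auto
    from realises_complement[OF this] show ?thesis
      using \<open>card V = c + d + 1\<close> by simp
  next
    case 3
    \<comment> \<open>Splitting off \<open>K\<^bsub>d+1\<^esub>\<close> fails only if it leaves the exceptional size \<open>2d + 1\<close>
      with \<open>d\<close> even.\<close>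
    define k where "k = (if even d \<and> card V = 3 * d + 2 then d + 2 else d + 1)"
    have k: "k \<le> card V" "d < k" "d < card V - k"
      using 3 by (auto simp: k_def elim!: evenE)
    obtain A B where AB: "A \<union> B = V" "A \<inter> B = {}" "finite A" "finite B"
      "card A = k" "card B = card V - k"
      using split_finite_set[OF less.prems(1) k(1)] by metis
    have "even (card A) \<or> even d \<and> card A \<noteq> 2 * d + 1"
      using AB(5) 3 by (auto simp: k_def)
    then have "realises A (\<lambda>_. d)"
      using AB k by (intro less.hyps) auto
    moreover have "even (card B) \<or> even d \<and> card B \<noteq> 2 * d + 1"
      using AB(6) 3 less.prems(3) by (auto simp: k_def)
    then have "realises B (\<lambda>_. d)"
      using AB k by (intro less.hyps) auto
    ultimately show ?thesis
      using realises_union[of A "\<lambda>_. d" B] AB by simp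
  qed
qed

text \<open>For odd order and odd \<open>d\<close>, parity of the degree sum rules out a
  \<open>d\<close>-regular graph; a single vertex of degree \<open>d - 1\<close> is the best
  possible.\<close>

lemma realises_near_regular:
  assumes "finite V" "odd (card V)" "odd d" "3 \<le> d" "d + 2 \<le> card V" "card V \<noteq> 2 * d + 1"
  shows "\<exists>x\<in>V. realises V (\<lambda>v. if v = x then d - 1 else d)"
proof -
  have small: "\<exists>x\<in>V. realises V (\<lambda>v. if v = x then d - 1 else d)"
    if V: "finite V" "odd (card V)" "d + 2 \<le> card V" "card V \<le> 2 * d - 1" for V :: "'a set"
  proof -
    define c where "c = card V - 1 - d"
    have cV: "card V = c + d + 1" and c: "1 \<le> c" "c + 2 \<le> d"
      using V by (auto simp: c_def)
    have "odd c" using cV V(2) \<open>odd d\<close> by simp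
    obtain A B where AB: "A \<union> B = V" "A \<inter> B = {}" "finite A" "finite B"
      "card A = c + 2" "card B = card V - (c + 2)"
      using split_finite_set[of V "c + 2"] V cV c by auto
    obtain x where x: "x \<in> A" using AB(5) by fastforce
    \<comment> \<open>A perfect matching on the other \<open>c + 1\<close> vertices of
      \<open>A\<close>, with \<open>x\<close> isolated. Its complement within \<open>A\<close> has
      degree \<open>c + 1\<close> at \<open>x\<close> and \<open>c\<close> elsewhere; the
      \<open>d - 1\<close> vertices of \<open>B\<close>, an even number above \<open>c\<close>,
      carry a \<open>c\<close>-regular cograph. Complementing the union in \<open>V\<close> gives
      the claim.\<close>
    let ?f = "\<lambda>v. if v = x then 0 else 1 :: nat"
    have "realises (A - {x}) (\<lambda>_. 1)"
      by (rule realises_regular) (use AB x \<open>odd c\<close> c in auto)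
    then have "realises (A - {x}) ?f" by (rule realises_cong) auto
    moreover have "realises {x} ?f"
      by (rule realises_cong[OF realises_zero]) auto
    ultimately have "realises A ?f"
      using realises_union[of "A - {x}" ?f "{x}"] x by (simp add: insert_absorb)
    let ?g = "\<lambda>v. if v = x then c + 1 else c"
    have "realises A ?g"
      by (rule realises_cong[OF realises_complement[OF \<open>realises A ?f\<close>]]) (use AB in auto)
    moreover have "realises B (\<lambda>_. c)"
      by (rule realises_regular) (use AB cV c \<open>odd d\<close> in auto)
    then have "realises B ?g"
      by (rule realises_cong) (use AB(2) x in auto)
    ultimately have "realises V ?g"
      using realises_union AB by metis
    then have "realises V (\<lambda>v. if v = x then d - 1 else d)"
      by (rule realises_cong[OF realises_complement]) (use cV in auto)
    then show ?thesis using x AB(1) by blast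
  qed
  show ?thesis
  proof (cases "card V \<le> 2 * d - 1")
    case True
    then show ?thesis using small assms by blast
  next
    case False
    then have ge: "card V \<ge> 2 * d + 3"
      using assms by presburger
    \<comment> \<open>\<open>A\<close> takes the deficient vertex; its size \<open>d + 2\<close> is
      in the range of \<open>small\<close> because \<open>3 \<le> d\<close>. The vertices left for
      \<open>B\<close> are even in number and more than \<open>d\<close>.\<close>
    obtain A B where AB: "A \<union> B = V" "A \<inter> B = {}" "finite A" "finite B"
      "card A = d + 2" "card B = card V - (d + 2)"
      using split_finite_set[of V "d + 2"] assms by auto
    have "\<exists>x\<in>A. realises A (\<lambda>v. if v = x then d - 1 else d)"
      by (rule small) (use AB assms(3,4) in auto)
    then obtain x where x: "x \<in> A" "realises A (\<lambda>v. if v = x then d - 1 else d)"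
      by blast
    have "realises B (\<lambda>_. d)"
      by (rule realises_regular) (use AB assms ge in auto)
    then have "realises B (\<lambda>v. if v = x then d - 1 else d)"
      by (rule realises_cong) (use AB(2) x in auto)
    then show ?thesis
      using realises_union[OF x(2)] AB x(1) by blast
  qed
qed

section \<open>Seinsche's theorem\<close>

text \<open>The relation is not assumed irreflexive, so that the lemma is closed under negating it and
  the two cases of the induction step are exchanged by complementation.\<close>

lemma P4_free_split:
  assumes "finite V" "2 \<le> card V" "\<And>x y. r x y \<Longrightarrow> r y x"
    and "\<And>a b c d. \<lbrakk>a \<in> V; b \<in> V; c \<in> V; d \<in> V; distinct [a, b, c, d]; r a b; r b c; r c d;
      \<not> r a c; \<not> r b d; \<not> r a d\<rbrakk> \<Longrightarrow> False"
  shows "\<exists>A B. A \<noteq> {} \<and> B \<noteq> {} \<and> A \<inter> B = {} \<and> A \<union> B = V \<and>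
    ((\<forall>a\<in>A. \<forall>b\<in>B. r a b) \<or> (\<forall>a\<in>A. \<forall>b\<in>B. \<not> r a b))"
  using assms
proof (induction V rule: finite_induct)
  case empty
  then show ?case by simp
next
  case (insert v W)
  \<comment> \<open>If no split of the enlarged set exists, an induced path through \<open>v\<close>
    appears. The relation is arbitrary because the step is applied to \<open>r\<close> and to its
    negation.\<close>
  have step: "\<exists>A B. A \<noteq> {} \<and> B \<noteq> {} \<and> A \<inter> B = {} \<and> A \<union> B = insert v W \<and>
    ((\<forall>a\<in>A. \<forall>b\<in>B. r a b) \<or> (\<forall>a\<in>A. \<forall>b\<in>B. \<not> r a b))"
    if AB: "A \<noteq> {}" "B \<noteq> {}" "A \<inter> B = {}" "A \<union> B = W" "\<forall>a\<in>A. \<forall>b\<in>B. \<not> r a b"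
      and sym: "\<And>x y. r x y \<Longrightarrow> r y x"
      and free: "\<And>a b c d. \<lbrakk>a \<in> insert v W; b \<in> insert v W; c \<in> insert v W; d \<in> insert v W;
        distinct [a, b, c, d]; r a b; r b c; r c d; \<not> r a c; \<not> r b d; \<not> r a d\<rbrakk> \<Longrightarrow> False"
    for A B and r :: "'a \<Rightarrow> 'a \<Rightarrow> bool"
  proof (rule ccontr)
    assume no_split: "\<not> ?thesis"
    have no_split': "\<exists>a\<in>X. \<exists>b\<in>insert v W - X. r a b" if "X \<noteq> {}" "X \<subset> insert v W" for X
    proof (rule ccontr)
      assume "\<not> ?thesis"
      then show False
        using no_split that
        by (metis Diff_disjoint Diff_partition psubset_imp_ex_mem empty_iff psubset_imp_subset)
    qed
    have "\<exists>u\<in>W. \<not> r v u"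
    proof (rule ccontr)
      assume "\<not> ?thesis"
      then have "(\<forall>a\<in>{v}. \<forall>b\<in>W. r a b)" by simp
      moreover have "W \<noteq> {}" using AB by auto
      ultimately show False
        using no_split insert.hyps(2)
        by (metis Int_insert_left_if0 Int_empty_left insert_is_Un insert_not_empty)
    qed
    then obtain u where u: "u \<in> W" "\<not> r v u" by blast
    \<comment> \<open>\<open>Q\<close> singles out the unions of components of \<open>r\<close> on
      \<open>W\<close> that contain \<open>u\<close>; the minimal one chosen below is the component
      of \<open>u\<close>.\<close>
    define Q where "Q = (\<lambda>C. u \<in> C \<and> C \<subseteq> W \<and> (\<forall>x\<in>C. \<forall>y\<in>W - C. \<not> r x y))"
    have no_cross: "\<not> r a b" "\<not> r b a" if "a \<in> A" "b \<in> B" for a b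
      using AB(5) sym[of b a] that by auto
    define C0 where "C0 = (if u \<in> A then A else B)"
    have "Q C0" "C0 \<noteq> W"
      using AB(1-4) u(1) no_cross by (auto simp: Q_def C0_def)
    have fin: "finite {C. Q C}"
      by (rule finite_subset[of _ "Pow W"]) (use insert.hyps in \<open>auto simp: Q_def\<close>)
    obtain C where C: "Q C" "C \<subseteq> C0" "\<And>D. Q D \<Longrightarrow> D \<subseteq> C \<Longrightarrow> D = C"
      using finite_has_minimal2[OF fin, of C0] \<open>Q C0\<close> by auto
    have "C \<subset> W"
      using C \<open>C0 \<noteq> W\<close> \<open>Q C0\<close> by (auto simp: Q_def)
    have nbr: "\<exists>x\<in>C. r v x"
    proof -
      have "C \<noteq> {}" "C \<subset> insert v W"
        using C(1) \<open>C \<subset> W\<close> by (auto simp: Q_def)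
      from no_split'[OF this]
      obtain a b where ab: "a \<in> C" "b \<in> insert v W - C" "r a b"
        by blast
      then have "b = v"
        using C(1) by (auto simp: Q_def)
      then show ?thesis using ab sym by blast
    qed
    \<comment> \<open>\<open>D\<close> contains \<open>u\<close> but misses a neighbour of
      \<open>v\<close> in \<open>C\<close>, so minimality of \<open>C\<close> yields adjacent
      \<open>y\<close> and \<open>x\<close> in \<open>C\<close> with only \<open>x\<close> adjacent
      to \<open>v\<close>. A neighbour \<open>z\<close> of \<open>v\<close> outside \<open>C\<close>
      completes the induced path y-x-v-z.\<close>
    define D where "D = {y \<in> C. \<not> r v y}"
    have "D \<noteq> C" "D \<subseteq> C"
      using nbr by (auto simp: D_def)
    then have "\<not> Q D"
      using C(3) by blast
    moreover have "u \<in> D" "D \<subseteq> W"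
      using C(1) u by (auto simp: Q_def D_def)
    ultimately obtain y x where "y \<in> D" "x \<in> W - D" "r y x"
      unfolding Q_def by blast
    then have yx: "y \<in> C" "\<not> r v y" "r y x" and x: "x \<in> C" "r v x"
      using C(1) by (auto simp: Q_def D_def)
    obtain z where z: "z \<in> W - C" "r v z"
    proof -
      have "W - C \<noteq> {}" "W - C \<subset> insert v W"
        using \<open>C \<subset> W\<close> insert.hyps(2) by auto
      from no_split'[OF this]
      obtain a b where ab: "a \<in> W - C" "b \<in> insert v W - (W - C)" "r a b"
        by blast
      then have "b = v"
        using C(1) sym[OF ab(3)] by (auto simp: Q_def)
      then show ?thesis using that ab sym by blast
    qed
    have nz: "\<not> r y z" "\<not> r x z"
      using C(1) yx x z by (auto simp: Q_def)
    have "distinct [y, x, v, z]"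
      using yx x z insert.hyps(2) C(1) by (auto simp: Q_def)
    moreover have "y \<in> insert v W" "x \<in> insert v W" "z \<in> insert v W"
      using yx x z C(1) by (auto simp: Q_def)
    moreover have "\<not> r y v" using yx(2) sym by blast
    ultimately show False
      using free[of y x v z] yx(3) sym[OF x(2)] z(2) nz by blast
  qed
  have "card W = 0 \<longleftrightarrow> W = {}"
    using insert.hyps(1) by simp
  then consider "W = {}" | "card W = 1" | "2 \<le> card W"
    by linarith
  then show ?case
  proof cases
    case 1
    then show ?thesis using insert.prems by simp
  next
    case 2
    then obtain w where "W = {w}" by (auto simp: card_1_singleton_iff)
    then show ?thesis
      using insert.hyps by (intro exI[of _ "{v}"] exI[of _ "{w}"]) auto
  next
    case 3
    have "\<exists>A B. A \<noteq> {} \<and> B \<noteq> {} \<and> A \<inter> B = {} \<and> A \<union> B = W \<and>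
      ((\<forall>a\<in>A. \<forall>b\<in>B. r a b) \<or> (\<forall>a\<in>A. \<forall>b\<in>B. \<not> r a b))"
    proof (rule insert.IH[OF 3 insert.prems(2)])
      show False if "a \<in> W" "b \<in> W" "c \<in> W" "d \<in> W" "distinct [a, b, c, d]"
        "r a b" "r b c" "r c d" "\<not> r a c" "\<not> r b d" "\<not> r a d" for a b c d
        by (rule insert.prems(3)[of a b c d]) (use that in auto)
    qed
    then obtain A B where AB: "A \<noteq> {}" "B \<noteq> {}" "A \<inter> B = {}" "A \<union> B = W"
      "(\<forall>a\<in>A. \<forall>b\<in>B. r a b) \<or> (\<forall>a\<in>A. \<forall>b\<in>B. \<not> r a b)"
      by blast
    from AB(5) show ?thesis
    proof
      assume no: "\<forall>a\<in>A. \<forall>b\<in>B. \<not> r a b"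
      show ?thesis
        by (rule step[OF AB(1-4) no]) (fact insert.prems(2), fact insert.prems(3))
    next
      assume "\<forall>a\<in>A. \<forall>b\<in>B. r a b"
      then have no: "\<forall>a\<in>A. \<forall>b\<in>B. \<not> \<not> r a b" by simp
      have "\<exists>A B. A \<noteq> {} \<and> B \<noteq> {} \<and> A \<inter> B = {} \<and> A \<union> B = insert v W \<and>
        ((\<forall>a\<in>A. \<forall>b\<in>B. \<not> r a b) \<or> (\<forall>a\<in>A. \<forall>b\<in>B. \<not> \<not> r a b))"
      proof (rule step[OF AB(1-4) no])
        show "\<not> r y x" if "\<not> r x y" for x y
          using that insert.prems(2) by blast
        show False
          if "a \<in> insert v W" "b \<in> insert v W" "c \<in> insert v W" "d \<in> insert v W"
            "distinct [a, b, c, d]" "\<not> r a b" "\<not> r b c" "\<not> r c d"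
            "\<not> \<not> r a c" "\<not> \<not> r b d" "\<not> \<not> r a d" for a b c d
          \<comment> \<open>A path a-b-c-d of the negated relation is a path c-a-d-b of
            \<open>r\<close>.\<close>
          by (rule insert.prems(3)[of c a d b])
            (use that insert.prems(2)[of a c] insert.prems(2)[of b d] insert.prems(2)[of c b]
              in auto)
      qed
      then show ?thesis
        by (simp only: not_not disj_commute)
    qed
  qed
qed

text \<open>The assumption \<open>conn\<close> expresses connectedness of \<open>C\<close>. If
  \<open>C\<close> has at least two vertices, Seinsche's theorem makes it a join; every vertex sees
  the whole opposite side, so both sides have at most \<open>d\<close> vertices, and the side
  opposite to \<open>w\<close> has fewer.\<close>

lemma connected_closed_component_bound:
  assumes G: "cograph G" and C: "closed_in G C"
    and conn: "\<And>X. X \<noteq> {} \<Longrightarrow> X \<subset> C \<Longrightarrow> \<not> closed_in G X"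
    and deg: "\<And>v. v \<in> C \<Longrightarrow> degree G v \<le> d"
    and w: "w \<in> C" "degree G w < d"
  shows "card C \<le> 2 * d - 1"
proof (cases "2 \<le> card C")
  case False
  \<comment> \<open>\<open>degree G w < d\<close> forces \<open>1 \<le> d\<close>, so one vertex is
    within the bound.\<close>
  then show ?thesis using w by linarith
next
  case True
  note simple = cograph_simple[OF G]
  have fin: "finite C"
    using C simple by (auto simp: closed_in_def simple_graph_def intro: finite_subset)
  have "\<exists>A B. A \<noteq> {} \<and> B \<noteq> {} \<and> A \<inter> B = {} \<and> A \<union> B = C \<and>
    ((\<forall>a\<in>A. \<forall>b\<in>B. {a, b} \<in> edges G) \<or> (\<forall>a\<in>A. \<forall>b\<in>B. {a, b} \<notin> edges G))"
    by (rule P4_free_split[OF fin True])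
      (use G in \<open>auto simp: insert_commute cograph_iff\<close>)
  then obtain A B where AB: "A \<noteq> {}" "B \<noteq> {}" "A \<inter> B = {}" "A \<union> B = C"
    "(\<forall>a\<in>A. \<forall>b\<in>B. {a, b} \<in> edges G) \<or> (\<forall>a\<in>A. \<forall>b\<in>B. {a, b} \<notin> edges G)"
    by blast
  \<comment> \<open>With no edge between \<open>A\<close> and \<open>B\<close>, the set
    \<open>A\<close> would be closed, against \<open>conn\<close>.\<close>
  have join: "\<forall>a\<in>A. \<forall>b\<in>B. {a, b} \<in> edges G"
  proof (rule ccontr)
    assume "\<not> ?thesis"
    with AB(5) have no: "\<forall>a\<in>A. \<forall>b\<in>B. {a, b} \<notin> edges G" by blast
    have "e \<subseteq> A \<or> e \<inter> A = {}" if e: "e \<in> edges G" for e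
    proof -
      have "card e = 2" using simple e by (auto simp: simple_graph_def)
      then obtain x y where xy: "e = {x, y}" by (auto simp: card_2_iff)
      show ?thesis
        using closed_in_edge[OF C, of x y] closed_in_edge[OF C, of y x] e AB(4)
          no[rule_format, of x y] no[rule_format, of y x]
        by (auto simp: xy insert_commute)
    qed
    then have "closed_in G A"
      using C AB(4) by (auto simp: closed_in_def)
    then show False using conn[of A] AB by blast
  qed
  have deg_A: "card B \<le> degree G a" if "a \<in> A" for a
    unfolding degree_eq_card_neighbours[OF simple]
    by (rule card_mono[OF finite_neighbours[OF simple]]) (use join that in auto)
  have deg_B: "card A \<le> degree G b" if "b \<in> B" for b
    unfolding degree_eq_card_neighbours[OF simple]
    by (rule card_mono[OF finite_neighbours[OF simple]]) (use join that in \<open>auto simp: insert_commute\<close>)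
  have "card B \<le> d" "card A \<le> d"
    using AB deg deg_A deg_B by (meson Un_iff equals0I le_trans)+
  moreover have "card B < d \<or> card A < d"
    using w AB(4) deg_A deg_B by (meson Un_iff le_less_trans)
  moreover have "card C = card A + card B"
    using AB(3,4) fin by (metis card_Un_disjoint finite_Un)
  ultimately show ?thesis by linarith
qed

section \<open>Extremal cographs\<close>

text \<open>Putting a cograph with degrees \<open>f\<close> on \<open>S\<close> keeps all other
  degrees and respects the bound \<open>d\<close>. Extremality compares edge numbers, hence degree
  sums, and the contributions outside \<open>S\<close> cancel.\<close>

lemma star_extremal_exchange:
  assumes ext: "star_extremal (Suc d) G" and S: "closed_in G S"
    and f: "realises S f" "\<And>v. v \<in> S \<Longrightarrow> f v \<le> d"
  shows "sum f S \<le> sum (degree G) S"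
proof -
  let ?V = "verts G"
  let ?f = "\<lambda>v. if v \<in> S then f v else degree G v"
  have G: "cograph G" and simple: "simple_graph G"
    using ext by (auto simp: star_extremal_def cograph_def)
  have SV: "S \<subseteq> ?V" using S by (simp add: closed_in_def)
  have deg: "degree G v \<le> d" if "v \<in> ?V" for v
    using ext contains_star_iff[OF simple, of "Suc d"] that by (auto simp: star_extremal_def)
  have "realises S ?f"
    by (rule realises_cong[OF f(1)]) simp
  moreover have "realises (?V - S) ?f"
    unfolding realises_def
    using cograph_induced[OF G, of "?V - S"] degree_induced_closed[OF closed_in_compl[OF simple S]]
    by (intro exI[of _ "induced G (?V - S)"]) (auto simp: induced_def)
  ultimately have "realises ?V ?f"
    using realises_union[of S ?f "?V - S"] SV by (simp add: Un_absorb1)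
  then obtain H where H: "cograph H" "verts H = ?V" "\<forall>v\<in>?V. degree H v = ?f v"
    by (auto simp: realises_def)
  have "\<not> contains_subgraph H (star (Suc d))"
    using contains_star_iff[OF cograph_simple[OF H(1)], of "Suc d"] H f(2) deg
    by (auto simp: not_less_eq_eq split: if_splits)
  then have "card (edges H) \<le> card (edges G)"
    using ext H by (simp add: star_extremal_def)
  then have "(\<Sum>v\<in>?V. ?f v) \<le> (\<Sum>v\<in>?V. degree G v)"
    using sum_degree[OF cograph_simple[OF H(1)]] sum_degree[OF simple] H by simp
  moreover have "sum g ?V = sum g (?V - S) + sum g S" for g :: "'a \<Rightarrow> nat"
    by (rule sum.subset_diff[OF SV simple_graph_finite_verts[OF simple]])
  ultimately show ?thesis by simp
qed

text \<open>Each part falls short of \<open>d\<close> times its size, so together they lose at least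
  2 against \<open>m * d\<close>, while a regular replacement loses 0 and a nearly regular one loses
  1. In the other two cases a degree is also bounded through the size of its part.\<close>

lemma two_deficient_parts_improvable:
  assumes ext: "star_extremal (Suc d) G"
    and C: "closed_in G C" and D: "closed_in G D" and disj: "C \<inter> D = {}"
    and size: "card C \<le> 2 * d - 1" "card D \<le> 2 * d - 1"
    and u: "u \<in> C" "degree G u < d" and w: "w \<in> D" "degree G w < d"
  shows False
proof -
  define m where "m = card (C \<union> D)"
  have simple: "simple_graph G"
    using ext by (auto simp: star_extremal_def cograph_def)
  have fin: "finite C" "finite D"
    using C D simple by (auto simp: closed_in_def simple_graph_def intro: finite_subset)
  have m: "m = card C + card D"
    unfolding m_def using fin disj by (rule card_Un_disjoint)
  have pos: "0 < card C" "0 < card D"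
    using u w fin by (auto simp: card_gt_0_iff)
  have deg: "degree G v \<le> d" if "v \<in> verts G" for v
    using ext contains_star_iff[OF simple, of "Suc d"] that by (auto simp: star_extremal_def)
  have sum_Un: "sum (degree G) (C \<union> D) = sum (degree G) C + sum (degree G) D"
    using fin disj by (rule sum.union_disjoint)
  have lt: "sum (degree G) X < card X * d"
    if "closed_in G X" "finite X" "x \<in> X" "degree G x < d" for X x
  proof -
    have "sum (degree G) X < (\<Sum>_\<in>X. d)"
      by (rule sum_strict_mono_ex1) (use that deg in \<open>auto simp: closed_in_def\<close>)
    then show ?thesis by simp
  qed
  note ltC = lt[OF C fin(1) u] and ltD = lt[OF D fin(2) w]
  have exch: "sum f (C \<union> D) \<le> sum (degree G) C + sum (degree G) D"
    if "realises (C \<union> D) f" "\<And>v. v \<in> C \<union> D \<Longrightarrow> f v \<le> d" for f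
    using star_extremal_exchange[OF ext closed_in_Un[OF C D] that] by (simp only: sum_Un)
  have small: "sum (degree G) X \<le> card X * (card X - 1)" if "closed_in G X" "finite X" for X
  proof -
    have "degree G x \<le> card X - 1" if "x \<in> X" for x
      using degree_less_card_closed[OF simple \<open>finite X\<close> that closed_in_edge[OF \<open>closed_in G X\<close>]]
      by fastforce
    then show ?thesis
      using sum_bounded_above[of X "degree G" "card X - 1"] by simp
  qed
  consider (complete) "m \<le> d + 1"
    | (reg) "d + 2 \<le> m" "even m \<or> even d \<and> m \<noteq> 2 * d + 1"
    | (mid) "m = 2 * d + 1"
    | (near) "d + 2 \<le> m" "odd m" "odd d" "m \<noteq> 2 * d + 1"
    by linarith
  then show False
  proof cases
    case complete
    have "m * (m - 1) \<le> sum (degree G) C + sum (degree G) D"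
      using exch[OF realises_complete] complete fin by (simp add: m_def[symmetric])
    also have "\<dots> \<le> card C * (card C - 1) + card D * (card D - 1)"
      using small[OF C fin(1)] small[OF D fin(2)] by simp
    \<comment> \<open>The other part is nonempty, so each part has at most \<open>m - 1\<close>
      vertices.\<close>
    also have "\<dots> \<le> card C * (m - 2) + card D * (m - 2)"
      using m pos by (intro add_mono mult_le_mono2) auto
    also have "\<dots> = m * (m - 2)"
      by (simp add: m add_mult_distrib)
    finally show False using m pos by simp
  next
    case reg
    have "realises (C \<union> D) (\<lambda>_. d)"
      by (rule realises_regular) (use reg fin in \<open>auto simp: m_def\<close>)
    from exch[OF this] have "m * d \<le> sum (degree G) C + sum (degree G) D"
      by (simp add: m_def[symmetric])
    then show False using ltC ltD by (simp add: m add_mult_distrib)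
  next
    case mid
    obtain A B where AB: "A \<union> B = C \<union> D" "A \<inter> B = {}" "finite A" "finite B"
      "card A = d + 1" "card B = d"
      using split_finite_set[of "C \<union> D" "d + 1"] mid fin by (auto simp: m_def)
    \<comment> \<open>The degrees of two disjoint complete graphs, on \<open>A\<close> and on
      \<open>B\<close>, with sum \<open>2 * d * d\<close>.\<close>
    let ?f = "\<lambda>v. if v \<in> A then d else d - 1"
    have "realises A ?f"
      by (rule realises_cong[OF realises_complete]) (use AB in auto)
    moreover have "realises B ?f"
      by (rule realises_cong[OF realises_complete]) (use AB in auto)
    ultimately have "realises (C \<union> D) ?f"
      using realises_union AB by metis
    from exch[OF this] have "sum ?f (A \<union> B) \<le> sum (degree G) C + sum (degree G) D"
      by (simp add: AB(1))
    moreover have "sum ?f (A \<union> B) = (d + 1) * d + d * (d - 1)"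
    proof -
      have "sum ?f B = (\<Sum>_\<in>B. d - 1)"
        by (rule sum.cong) (use AB(2) in auto)
      then show ?thesis
        using AB(5,6) by (simp add: sum.union_disjoint[OF AB(3,4,2)])
    qed
    ultimately have ge: "(d + 1) * d + d * (d - 1) \<le> sum (degree G) C + sum (degree G) D"
      by simp
    \<comment> \<open>As the sizes add up to \<open>2 * d + 1\<close>, one of the two parts has at
      most \<open>d\<close> vertices and takes the role of \<open>X\<close>.\<close>
    have False if X: "card X \<le> d" "0 < card X" "sum (degree G) X \<le> card X * (card X - 1)"
      and Y: "sum (degree G) Y < card Y * d" and XY: "card X + card Y = 2 * d + 1"
      and ge: "(d + 1) * d + d * (d - 1) \<le> sum (degree G) X + sum (degree G) Y" for X Y
    proof -
      obtain j where j: "card X = Suc j" using X(2) by (cases "card X") auto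
      obtain i where i: "d = Suc j + i" using X(1) j by (metis le_iff_add)
      have "card Y = Suc (j + 2 * i + 1)" using XY j i by simp
      \<comment> \<open>The left side is \<open>2 * d * d\<close>, the right side
        \<open>2 * d * d - j * i\<close>.\<close>
      then have "(d + 1) * d + d * (d - 1) < Suc j * j + (j + 2 * i + 2) * d"
        using X(3) Y ge j by simp
      then show False by (simp add: i algebra_simps)
    qed
    from this[of C D] this[of D C] show False
      using small[OF C fin(1)] small[OF D fin(2)] ltC ltD ge mid m pos by linarith
  next
    case near
    \<comment> \<open>For \<open>d = 1\<close> the size bounds leave one vertex in each part, too
      few for \<open>d + 2 \<le> m\<close>.\<close>
    have "d \<noteq> 1"
    proof
      assume "d = 1"
      with size near(1) m show False by linarith
    qed
    then have "3 \<le> d" using \<open>odd d\<close> by presburger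
    then obtain x where x: "x \<in> C \<union> D" "realises (C \<union> D) (\<lambda>v. if v = x then d - 1 else d)"
      using realises_near_regular[of "C \<union> D" d] near fin by (auto simp: m_def)
    from exch[OF x(2)]
    have "(\<Sum>v\<in>C \<union> D. if v = x then d - 1 else d) \<le> sum (degree G) C + sum (degree G) D"
      by simp
    moreover have "(\<Sum>v\<in>C \<union> D. if v = x then d - 1 else d) = d - 1 + (\<Sum>_\<in>C \<union> D - {x}. d)"
      using x(1) fin by (subst sum.remove[of _ x]) (auto intro: sum.cong)
    moreover have "\<dots> + 1 = m * d"
    proof -
      have "(\<Sum>_\<in>C \<union> D. d) = d + (\<Sum>_\<in>C \<union> D - {x}. d)"
        using x(1) fin by (subst sum.remove[of _ x]) auto
      then show ?thesis using \<open>3 \<le> d\<close> by (simp add: m_def)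
    qed
    ultimately show False
      using ltC ltD by (simp add: m add_mult_distrib)
  qed
qed

section \<open>Connected components\<close>

definition component :: "'a graph \<Rightarrow> 'a \<Rightarrow> 'a set" where
  "component G v = {u. (v, u) \<in> {(x, y). {x, y} \<in> edges G}\<^sup>*}"

lemma component_subset_closed:
  assumes "closed_in G X" "v \<in> X"
  shows "component G v \<subseteq> X"
proof
  fix u assume "u \<in> component G v"
  then have "(v, u) \<in> {(x, y). {x, y} \<in> edges G}\<^sup>*" by (simp add: component_def)
  then show "u \<in> X"
    by (induction rule: rtrancl_induct) (use assms closed_in_edge in auto)
qed

lemma closed_in_component:
  assumes "simple_graph G" "v \<in> verts G"
  shows "closed_in G (component G v)"
proof -
  have "closed_in G (verts G)"
    using assms(1) by (auto simp: closed_in_def simple_graph_def)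
  then have "component G v \<subseteq> verts G"
    using component_subset_closed assms(2) by metis
  moreover have "e \<subseteq> component G v" if e: "e \<in> edges G" "e \<inter> component G v \<noteq> {}" for e
  proof -
    have "card e = 2" using assms(1) e by (auto simp: simple_graph_def)
    then obtain x y where "e = {x, y}" "x \<in> component G v"
      using e(2) by (auto simp: card_2_iff insert_commute)
    then show ?thesis
      using e(1) by (auto simp: component_def intro: rtrancl_into_rtrancl)
  qed
  ultimately show ?thesis by (auto simp: closed_in_def)
qed

lemma self_in_component: "v \<in> component G v"
  by (simp add: component_def)

lemma component_sym:
  assumes "u \<in> component G v"
  shows "v \<in> component G u"
proof -
  have "sym {(x, y). {x, y} \<in> edges G}"
    by (auto simp: sym_def insert_commute)
  from sym_rtrancl[OF this] show ?thesis
    using assms by (auto simp: component_def dest: symD)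
qed

text \<open>Walks can be reversed, so a closed \<open>X\<close> meeting the component from within
  contains \<open>v\<close>, and then the whole component. This is the connectedness asked for by
  \<open>connected_closed_component_bound\<close>.\<close>

lemma component_minimal:
  assumes "X \<noteq> {}" "X \<subset> component G v"
  shows "\<not> closed_in G X"
proof
  assume X: "closed_in G X"
  obtain x where x: "x \<in> X" using assms(1) by blast
  have "v \<in> component G x"
    by (rule component_sym) (use assms(2) x in auto)
  then have "v \<in> X"
    using component_subset_closed[OF X x] by auto
  from component_subset_closed[OF X this] show False
    using assms(2) by simp
qed

text \<open>All vertices on a walk from \<open>v\<close> lie in the component, so the walk survives
  in the induced subgraph; any two vertices are joined through \<open>v\<close>.\<close>

lemma connected_induced_component:
  assumes "simple_graph G" "v \<in> verts G"
  shows "connected_graph (induced G (component G v))"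
proof -
  let ?C = "component G v"
  let ?r = "{(x, y). {x, y} \<in> edges (induced G ?C)}"
  have reach: "(v, u) \<in> ?r\<^sup>*" if "u \<in> ?C" for u
  proof -
    have "(v, u) \<in> {(x, y). {x, y} \<in> edges G}\<^sup>*" using that by (simp add: component_def)
    then show ?thesis
    proof (induction rule: rtrancl_induct)
      case (step x y)
      then have "x \<in> ?C" "y \<in> ?C"
        by (auto simp: component_def intro: rtrancl_into_rtrancl)
      with step.hyps(2) have "(x, y) \<in> ?r" by (auto simp: induced_def)
      with step.IH show ?case by (rule rtrancl_into_rtrancl)
    qed simp
  qed
  have "sym ?r" by (auto simp: sym_def insert_commute)
  then have "sym (?r\<^sup>*)" by (rule sym_rtrancl)
  then have "(u, w) \<in> ?r\<^sup>*" if "u \<in> ?C" "w \<in> ?C" for u w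
    using reach[OF that(1)] reach[OF that(2)] by (meson rtrancl_trans symD)
  then show ?thesis by (auto simp: connected_graph_def induced_def)
qed

theorem theorem2:
  fixes t n :: nat and G :: "'a graph"
  assumes "1 \<le> t" and "1 \<le> n" and "t \<le> n"
    and "star_extremal t G" and "card (verts G) = n"
  shows "if even n \<or> (even (t - 1) \<and> 2 * t \<noteq> n + 1)
         then regular (t - 1) G
         else (\<exists>H R. cograph H \<and> regular (t - 1) H \<and>
                 simple_graph R \<and> connected_graph R \<and> card (verts R) \<le> 2 * t - 3 \<and>
                 is_sum G H R)"
proof -
  \<comment> \<open>In terms of \<open>d\<close> the exception \<open>2 * t = n + 1\<close> reads
    \<open>n = 2 * d + 1\<close>, and the bound \<open>2 * t - 3\<close> reads
    \<open>2 * d - 1\<close>, also under truncation at \<open>d = 0\<close>.\<close>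
  obtain d where t: "t = Suc d" using assms(1) by (cases t) auto
  have ext: "star_extremal (Suc d) G" using assms(4) t by simp
  have G: "cograph G" and simple: "simple_graph G"
    using ext by (auto simp: star_extremal_def cograph_def)
  have deg: "degree G v \<le> d" if "v \<in> verts G" for v
    using ext contains_star_iff[OF simple, of "Suc d"] that by (auto simp: star_extremal_def)
  have "regular d G" if "even n \<or> even d \<and> n \<noteq> 2 * d + 1"
  proof (rule ccontr)
    assume "\<not> ?thesis"
    then obtain v where v: "v \<in> verts G" "degree G v < d"
      using deg by (auto simp: regular_def nat_less_le)
    \<comment> \<open>The exchange is made on the whole vertex set; \<open>t \<le> n\<close>
      supplies \<open>d < card (verts G)\<close>.\<close>
    have "realises (verts G) (\<lambda>_. d)"
      by (rule realises_regular) (use that assms simple t in \<open>auto simp: simple_graph_finite_verts\<close>)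
    moreover have "closed_in G (verts G)"
      using simple by (auto simp: closed_in_def simple_graph_def)
    ultimately have "(\<Sum>_\<in>verts G. d) \<le> sum (degree G) (verts G)"
      using star_extremal_exchange[OF ext] by blast
    moreover have "sum (degree G) (verts G) < (\<Sum>_\<in>verts G. d)"
      by (rule sum_strict_mono_ex1) (use v deg simple in \<open>auto simp: simple_graph_finite_verts\<close>)
    ultimately show False by simp
  qed
  moreover have "\<exists>H R. cograph H \<and> regular d H \<and> simple_graph R \<and> connected_graph R \<and>
    card (verts R) \<le> 2 * d - 1 \<and> is_sum G H R"
  proof (cases "regular d G")
    case True
    \<comment> \<open>The remainder is the null graph.\<close>
    then show ?thesis
      using G by (intro exI[of _ G] exI[of _ "\<lparr>verts = {}, edges = {}\<rparr>"])
        (auto simp: simple_graph_def connected_graph_def is_sum_def)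
  next
    case False
    then obtain v where v: "v \<in> verts G" "degree G v < d"
      using deg by (auto simp: regular_def nat_less_le)
    have bound: "card (component G x) \<le> 2 * d - 1" if "x \<in> verts G" "degree G x < d" for x
    proof (rule connected_closed_component_bound[OF G closed_in_component[OF simple that(1)]
          component_minimal _ self_in_component that(2)])
      show "degree G y \<le> d" if "y \<in> component G x" for y
        using closed_in_component[OF simple \<open>x \<in> verts G\<close>] that deg by (auto simp: closed_in_def)
    qed
    \<comment> \<open>The component of one deficient vertex is the remainder. A deficient vertex
      outside it would have a component disjoint from \<open>C\<close>, and the two components could
      be improved together.\<close>
    define C where "C = component G v"
    have C: "closed_in G C" using closed_in_component[OF simple v(1)] by (simp add: C_def)
    have compl: "closed_in G (verts G - C)" using simple C by (rule closed_in_compl)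
    have "degree G w = d" if w: "w \<in> verts G - C" for w
    proof (rule ccontr)
      assume "degree G w \<noteq> d"
      then have w': "w \<in> verts G" "degree G w < d" using deg w by (auto simp: nat_less_le)
      have "C \<inter> component G w = {}"
        using component_subset_closed[OF compl w] by auto
      from two_deficient_parts_improvable[OF ext C closed_in_component[OF simple w'(1)] this
          bound[OF v, folded C_def] bound[OF w'] _ v(2) self_in_component w'(2)]
      show False by (simp add: C_def self_in_component)
    qed
    then have "regular d (induced G (verts G - C))"
      using degree_induced_closed[OF compl] by (simp add: regular_def induced_def)
    moreover have "cograph (induced G (verts G - C))"
      using G by (rule cograph_induced) auto
    moreover have "simple_graph (induced G C)"
      using simple C by (intro simple_induced) (auto simp: closed_in_def)
    moreover have "connected_graph (induced G C)"
      unfolding C_def using simple v(1) by (rule connected_induced_component)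
    moreover have "card (verts (induced G C)) \<le> 2 * d - 1"
      using bound[OF v] by (simp add: C_def induced_def)
    moreover have "is_sum G (induced G (verts G - C)) (induced G C)"
      using C simple by (auto simp: is_sum_def induced_def closed_in_def simple_graph_def)
    ultimately show ?thesis by blast
  qed
  ultimately show ?thesis by (simp add: t)
qed

end
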